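(* The most general type of an anisotropic medium that allows propagation of purely polarized waves in an arbitrary direction has an elasticity tensor whose symmetric $6\times 6$ Voigt matrix is of the form $$C^{IJ}=\begin{bmatrix} \alpha & \alpha/3+2\rho_1 & \alpha/3+2\rho_2 & 2\rho_3 & 0 & 0\\ * & \alpha & \alpha/3+2\rho_4 & 0 & 2\rho_5 & 0\\ * & * & \alpha & 0 & 0 & 2\rho_6\\ * & * & * & \alpha/3-\rho_4 & -\rho_6 & -\rho_5\\ * & * & * & * & \alpha/3-\rho_2 & -\rho_3\\ * & * & * & * & * & \alpha/3-\rho_1 \end{bmatrix},$$ where $\rho_1,\dots,\rho_6$ are arbitrary parameters. The velocity of the longitudinal waves in this medium is $v_{\rm L}=\sqrt{3\alpha}=\sqrt{\lambda+2\mu}$, where $\alpha=(\lambda+2\mu)/3$.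
   Context: Indices $i,j,k,l$ run over $1,2,3$; summation over repeated indices; Cartesian coordinates with $g^{ij}=\mathrm{diag}(1,1,1)$. An elasticity tensor is a constant real fourth-rank tensor $C^{ijkl}$ with $C^{ijkl}=C^{jikl}=C^{ijlk}$ and $C^{ijkl}=C^{klij}$. Voigt notation replaces symmetric index pairs by $11\to1$, $22\to2$, $33\to3$, $23\to4$, $31\to5$, $12\to6$, so $C^{ijkl}$ becomes a symmetric matrix $C^{IJ}$ (e.g. $C^{14}=C^{1123}$); stars denote entries fixed by symmetry. For a unit vector $n$ the Christoffel matrix is $\Gamma^{il}(n)=C^{ijkl}n_jn_k$ (mass density normalized to 1); it is assumed positive definite. A wave in direction $n$ with phase velocity $v>0$ and polarization $U\neq0$ is a solution of $(v^2g^{il}-\Gamma^{il}(n))U_l=0$; it is longitudinal if $U$ is parallel to $n$ and transverse if $U\cdot n=0$. Propagation of purely polarized waves in direction $n$ means that one longitudinal and two independent transverse waves can propagate in direction $n$. The symbols $\lambda,\mu$ are the Lamé moduli of an isotropic medium $C^{ijkl}=\lambda g^{ij}g^{kl}+\mu(g^{ik}g^{lj}+g^{il}g^{jk})$, whose totally symmetric part is $\alpha(g^{ij}g^{kl}+g^{ik}g^{lj}+g^{il}g^{jk})$ with $\alpha=(\lambda+2\mu)/3$; the media in the claim are those obtained from such a totally symmetric part by adding an arbitrary tensor $A^{ijkl}$ having the symmetries of an elasticity tensor and vanishing total symmetrization.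
   Formalization: The matrix as printed has leading entry α, giving v_L = √α (e.g. α=1, all ρ=0), not √(3α). For the velocity and Lamé-moduli claims, α in the matrix is replaced by 3α, where α=(λ+2μ)/3; the characterization of the matrix form uses an arbitrary leading entry a. *)

theory Defs
  imports "HOL-Analysis.Analysis"
begin

type_synonym tensor4 = "real^3^3^3^3"

definition elasticity_tensor :: "tensor4 \<Rightarrow> bool" where
  "elasticity_tensor C \<longleftrightarrow>
     (\<forall>i j k l. C $ i $ j $ k $ l = C $ j $ i $ k $ l \<and>
                C $ i $ j $ k $ l = C $ i $ j $ l $ k \<and>
                C $ i $ j $ k $ l = C $ k $ l $ i $ j)"

text \<open>The Euclidean metric is the identity matrix \<^term>\<open>mat 1\<close>.\<close>

definition isotropic_tensor :: "real \<Rightarrow> real \<Rightarrow> tensor4" where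
  "isotropic_tensor lam \<mu> =
     (let g = mat 1 :: real^3^3 in
      \<chi> i j k l. lam * (g $ i $ j * g $ k $ l)
                 + \<mu> * (g $ i $ k * g $ l $ j + g $ i $ l * g $ j $ k))"

definition total_sym :: "tensor4 \<Rightarrow> tensor4" where
  "total_sym T =
     (\<chi> i j k l. let s = [i, j, k, l] in
        (1 / fact 4) * (\<Sum>p | p permutes {..<4::nat}.
           T $ (s ! p 0) $ (s ! p 1) $ (s ! p 2) $ (s ! p 3)))"

text \<open>
  In the type \<^typ>\<open>6\<close> the numeral 6 denotes the same element as 0, so the last case below
  is the sixth Voigt index; likewise 3 is 0 in \<^typ>\<open>3\<close>.
\<close>

definition voigt_pair :: "6 \<Rightarrow> 3 \<times> 3" where
  "voigt_pair I =
     (if I = 1 then (1, 1) else if I = 2 then (2, 2) else if I = 3 then (3, 3)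
      else if I = 4 then (2, 3) else if I = 5 then (3, 1) else (1, 2))"

definition voigt :: "tensor4 \<Rightarrow> real^6^6" where
  "voigt C = (\<chi> I J. C $ fst (voigt_pair I) $ snd (voigt_pair I)
                       $ fst (voigt_pair J) $ snd (voigt_pair J))"

definition christoffel :: "tensor4 \<Rightarrow> real^3 \<Rightarrow> real^3^3" where
  "christoffel C n = (\<chi> i l. \<Sum>j\<in>UNIV. \<Sum>k\<in>UNIV. C $ i $ j $ k $ l * n $ j * n $ k)"

definition pos_definite :: "real^3^3 \<Rightarrow> bool" where
  "pos_definite G \<longleftrightarrow> (\<forall>U. U \<noteq> 0 \<longrightarrow> U \<bullet> (G *v U) > 0)"

definition wave :: "tensor4 \<Rightarrow> real^3 \<Rightarrow> real \<Rightarrow> real^3 \<Rightarrow> bool" where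
  "wave C n v U \<longleftrightarrow> v > 0 \<and> U \<noteq> 0 \<and> (v\<^sup>2 *\<^sub>R mat 1 - christoffel C n) *v U = 0"

definition longitudinal_wave :: "tensor4 \<Rightarrow> real^3 \<Rightarrow> real \<Rightarrow> real^3 \<Rightarrow> bool" where
  "longitudinal_wave C n v U \<longleftrightarrow> wave C n v U \<and> (\<exists>c. U = c *\<^sub>R n)"

definition transverse_wave :: "tensor4 \<Rightarrow> real^3 \<Rightarrow> real \<Rightarrow> real^3 \<Rightarrow> bool" where
  "transverse_wave C n v U \<longleftrightarrow> wave C n v U \<and> U \<bullet> n = 0"

text \<open>The three waves may have three different velocities.\<close>

definition purely_polarized_waves :: "tensor4 \<Rightarrow> real^3 \<Rightarrow> bool" where
  "purely_polarized_waves C n \<longleftrightarrow>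
     (\<exists>v U. longitudinal_wave C n v U) \<and>
     (\<exists>v\<^sub>1 U\<^sub>1 v\<^sub>2 U\<^sub>2. transverse_wave C n v\<^sub>1 U\<^sub>1 \<and> transverse_wave C n v\<^sub>2 U\<^sub>2 \<and>
        U\<^sub>1 \<noteq> U\<^sub>2 \<and> independent {U\<^sub>1, U\<^sub>2})"

text \<open>
  The leading entry \<open>a\<close> is the entry with all four tensor indices equal. For the totally
  symmetric part of an isotropic medium, \<open>\<alpha> (g\<^sup>i\<^sup>j g\<^sup>k\<^sup>l + g\<^sup>i\<^sup>k g\<^sup>l\<^sup>j + g\<^sup>i\<^sup>l g\<^sup>j\<^sup>k)\<close>, it is
  three times the coefficient: \<open>a = 3 \<alpha> = lam + 2 \<mu>\<close>.
\<close>

definition polarization_matrix ::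
  "real \<Rightarrow> real \<Rightarrow> real \<Rightarrow> real \<Rightarrow> real \<Rightarrow> real \<Rightarrow> real \<Rightarrow> real^6^6" where
  "polarization_matrix a \<rho>\<^sub>1 \<rho>\<^sub>2 \<rho>\<^sub>3 \<rho>\<^sub>4 \<rho>\<^sub>5 \<rho>\<^sub>6 = vector
     [vector [a,              a / 3 + 2 * \<rho>\<^sub>1, a / 3 + 2 * \<rho>\<^sub>2, 2 * \<rho>\<^sub>3,     0,          0],
      vector [a / 3 + 2 * \<rho>\<^sub>1, a,              a / 3 + 2 * \<rho>\<^sub>4, 0,          2 * \<rho>\<^sub>5,     0],
      vector [a / 3 + 2 * \<rho>\<^sub>2, a / 3 + 2 * \<rho>\<^sub>4, a,              0,          0,          2 * \<rho>\<^sub>6],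
      vector [2 * \<rho>\<^sub>3,         0,              0,              a / 3 - \<rho>\<^sub>4, - \<rho>\<^sub>6,       - \<rho>\<^sub>5],
      vector [0,              2 * \<rho>\<^sub>5,         0,              - \<rho>\<^sub>6,       a / 3 - \<rho>\<^sub>2, - \<rho>\<^sub>3],
      vector [0,              0,              2 * \<rho>\<^sub>6,         - \<rho>\<^sub>5,       - \<rho>\<^sub>3,       a / 3 - \<rho>\<^sub>1]]"

end

theory Submission
  imports Defs
begin

text \<open>
  The vector \<open>\<Gamma>(n) n\<close> has components \<open>C\<^sup>i\<^sup>j\<^sup>k\<^sup>l n\<^sub>j n\<^sub>k n\<^sub>l\<close>, so it depends only on the total
  symmetrization of \<open>C\<close>. Since \<open>\<Gamma>(n)\<close> is symmetric and positive definite, once \<open>n\<close> is an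
  eigenvector the plane orthogonal to \<open>n\<close> is invariant and supplies the two transverse waves, so
  pure polarization means exactly that \<open>\<Gamma>(n) n\<close> is parallel to \<open>n\<close>. By homogeneity this extends
  to all vectors, and testing the parallelism on a few vectors such as \<open>(1, \<plusminus>1, 0)\<close> and
  \<open>(1, 2, 0)\<close> forces the symmetrization of \<open>C\<close> to be isotropic.
\<close>

section \<open>Voigt indices as elements of the type \<open>6\<close>\<close>

lemma exhaust_6:
  fixes x :: 6
  shows "x = 1 \<or> x = 2 \<or> x = 3 \<or> x = 4 \<or> x = 5 \<or> x = 6"
proof (induct x)
  case (of_int z)
  then have "z \<in> {0..<6}" by simp
  also have "{0..<6::int} = {0,1,2,3,4,5}" by auto
  \<comment> \<open>The residue 0 is the element written \<open>6\<close>.\<close>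
  finally show ?case by auto
qed

lemma forall_6: "(\<forall>i::6. P i) \<longleftrightarrow> P 1 \<and> P 2 \<and> P 3 \<and> P 4 \<and> P 5 \<and> P 6"
  by (metis exhaust_6)

lemma vector_6:
  "(vector [a,b,c,d,e,f] :: 'a::zero^6) $ 1 = a"
  "(vector [a,b,c,d,e,f] :: 'a::zero^6) $ 2 = b"
  "(vector [a,b,c,d,e,f] :: 'a::zero^6) $ 3 = c"
  "(vector [a,b,c,d,e,f] :: 'a::zero^6) $ 4 = d"
  "(vector [a,b,c,d,e,f] :: 'a::zero^6) $ 5 = e"
  "(vector [a,b,c,d,e,f] :: 'a::zero^6) $ 6 = f"
  by (simp_all add: vector_def)

lemma voigt_pair_simps:
  "voigt_pair 1 = (1,1)" "voigt_pair 2 = (2,2)" "voigt_pair 3 = (3,3)"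
  "voigt_pair 4 = (2,3)" "voigt_pair 5 = (3,1)" "voigt_pair 6 = (1,2)"
  by (simp_all add: voigt_pair_def)

section \<open>Index symmetries and total symmetrization\<close>

lemma elasticity_tensorD:
  assumes "elasticity_tensor C"
  shows "C $ j $ i $ k $ l = C $ i $ j $ k $ l"
    and "C $ i $ j $ l $ k = C $ i $ j $ k $ l"
    and "C $ k $ l $ i $ j = C $ i $ j $ k $ l"
  using assms by (simp_all add: elasticity_tensor_def)

text \<open>The symmetries of \<open>T\<close> split the 24 permutations into three classes of
  eight, one for each way of pairing off the four indices.\<close>

lemma total_sym_elasticity:
  assumes "elasticity_tensor T"
  shows "total_sym T $ i $ j $ k $ l
    = (T $ i $ j $ k $ l + T $ i $ k $ j $ l + T $ i $ l $ j $ k) / 3"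
proof -
  note sym = elasticity_tensorD[OF assms]
  have fin: "finite {1, 2, 3::nat}" "0 \<notin> {1, 2, 3::nat}" "finite {2, 3::nat}" "1 \<notin> {2, 3::nat}"
    "finite {3::nat}" "2 \<notin> {3::nat}"
    by auto
  have set4: "{..<4::nat} = {0, 1, 2, 3}" by auto
  show ?thesis
    \<comment> \<open>Peeling off 0, 1 and 2 leaves the permutations of \<open>{3}\<close>. The
      symmetries are then instantiated at the fixed indices, so that rewriting sorts them and
      terminates.\<close>
    unfolding total_sym_def set4 sum_over_permutations_insert[OF fin(1,2)]
      sum_over_permutations_insert[OF fin(3,4)] sum_over_permutations_insert[OF fin(5,6)]
    by (simp add: transpose_def fact_numeral sym(1)[of j i] sym(1)[of k i] sym(1)[of l i]
       sym(1)[of k j] sym(1)[of l j] sym(1)[of l k]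
       sym(2)[of _ _ j i] sym(2)[of _ _ k i] sym(2)[of _ _ l i]
       sym(2)[of _ _ k j] sym(2)[of _ _ l j] sym(2)[of _ _ l k]
       sym(3)[of j k i l] sym(3)[of j l i k] sym(3)[of k l i j])
qed

lemma mat_1_commute: "(mat 1 :: 'a::zero_neq_one^'n^'n) $ i $ j = mat 1 $ j $ i"
  by (simp add: mat_def)

lemma elasticity_isotropic: "elasticity_tensor (isotropic_tensor lam \<mu>)"
  unfolding elasticity_tensor_def isotropic_tensor_def Let_def vec_lambda_beta
proof (intro allI conjI)
  fix i j k l :: 3
  note g = mat_1_commute[where 'a=real, of j i] mat_1_commute[where 'a=real, of k i]
    mat_1_commute[where 'a=real, of l i] mat_1_commute[where 'a=real, of k j]
    mat_1_commute[where 'a=real, of l j] mat_1_commute[where 'a=real, of l k]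
  let ?g = "mat 1 :: real^3^3"
  let ?C = "\<lambda>i j k l. lam * (?g $ i $ j * ?g $ k $ l) + \<mu> * (?g $ i $ k * ?g $ l $ j + ?g $ i $ l * ?g $ j $ k)"
  show "?C i j k l = ?C j i k l" "?C i j k l = ?C i j l k" "?C i j k l = ?C k l i j"
    by (simp_all only: g) (simp_all add: algebra_simps)
qed

text \<open>The totally symmetric isotropic tensor without its scalar factor. Its value at four
  equal indices is 3, which explains the factor \<open>a / 3\<close> below.\<close>

definition isotropic_sym :: "3 \<Rightarrow> 3 \<Rightarrow> 3 \<Rightarrow> 3 \<Rightarrow> real" where
  "isotropic_sym i j k l = (let g = mat 1 :: real^3^3 in
     g $ i $ j * g $ k $ l + g $ i $ k * g $ l $ j + g $ i $ l * g $ j $ k)"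

text \<open>Each product of two metrics symmetrizes to a third of \<open>isotropic_sym\<close>; one
  such product carries \<open>lam\<close> and two carry \<open>\<mu>\<close>.\<close>

lemma total_sym_isotropic:
  "total_sym (isotropic_tensor lam \<mu>) $ i $ j $ k $ l = (lam + 2 * \<mu>) / 3 * isotropic_sym i j k l"
proof -
  note g = mat_1_commute[where 'a=real, of k j]
    mat_1_commute[where 'a=real, of l j] mat_1_commute[where 'a=real, of l k]
  show ?thesis
    unfolding total_sym_elasticity[OF elasticity_isotropic]
    unfolding isotropic_tensor_def isotropic_sym_def
      Let_def vec_lambda_beta g
    by (simp add: field_simps)
qed

lemma total_sym_diff: "total_sym (S - T) = total_sym S - total_sym T"
  unfolding vec_eq_iff
  by (simp add: total_sym_def sum_subtractf right_diff_distrib diff_divide_distrib Let_def)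

text \<open>Rewrite rules that bring every component to one of the 21 in the upper triangle of the Voigt matrix.\<close>

lemma elasticity_tensor_canonical:
  assumes "elasticity_tensor C"
  shows "C $ 2 $ 1 $ k $ l = C $ 1 $ 2 $ k $ l" "C $ 3 $ 2 $ k $ l = C $ 2 $ 3 $ k $ l"
    "C $ 1 $ 3 $ k $ l = C $ 3 $ 1 $ k $ l"
    "C $ i $ j $ 2 $ 1 = C $ i $ j $ 1 $ 2" "C $ i $ j $ 3 $ 2 = C $ i $ j $ 2 $ 3"
    "C $ i $ j $ 1 $ 3 = C $ i $ j $ 3 $ 1"
    "C $ 2 $ 2 $ 1 $ 1 = C $ 1 $ 1 $ 2 $ 2" "C $ 3 $ 3 $ 1 $ 1 = C $ 1 $ 1 $ 3 $ 3"
    "C $ 2 $ 3 $ 1 $ 1 = C $ 1 $ 1 $ 2 $ 3" "C $ 3 $ 1 $ 1 $ 1 = C $ 1 $ 1 $ 3 $ 1"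
    "C $ 1 $ 2 $ 1 $ 1 = C $ 1 $ 1 $ 1 $ 2"
    "C $ 3 $ 3 $ 2 $ 2 = C $ 2 $ 2 $ 3 $ 3" "C $ 2 $ 3 $ 2 $ 2 = C $ 2 $ 2 $ 2 $ 3"
    "C $ 3 $ 1 $ 2 $ 2 = C $ 2 $ 2 $ 3 $ 1" "C $ 1 $ 2 $ 2 $ 2 = C $ 2 $ 2 $ 1 $ 2"
    "C $ 2 $ 3 $ 3 $ 3 = C $ 3 $ 3 $ 2 $ 3" "C $ 3 $ 1 $ 3 $ 3 = C $ 3 $ 3 $ 3 $ 1"
    "C $ 1 $ 2 $ 3 $ 3 = C $ 3 $ 3 $ 1 $ 2"
    "C $ 3 $ 1 $ 2 $ 3 = C $ 2 $ 3 $ 3 $ 1" "C $ 1 $ 2 $ 2 $ 3 = C $ 2 $ 3 $ 1 $ 2"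
    "C $ 1 $ 2 $ 3 $ 1 = C $ 3 $ 1 $ 1 $ 2"
  using assms unfolding elasticity_tensor_def by blast+

text \<open>A totally symmetric tensor has 15 independent components, one for each multiset of four
  indices, hence 15 equations. The last six involve two components of \<open>C\<close> each, which
  leaves six of its 21 components free.\<close>

lemma total_sym_eq_iff:
  assumes "elasticity_tensor C"
  shows "(\<forall>i j k l. total_sym C $ i $ j $ k $ l = a / 3 * isotropic_sym i j k l) \<longleftrightarrow>
    C$1$1$1$1 = a \<and> C$2$2$2$2 = a \<and> C$3$3$3$3 = a \<and>
    C$1$1$1$2 = 0 \<and> C$1$1$3$1 = 0 \<and> C$2$2$1$2 = 0 \<and> C$2$2$2$3 = 0 \<and> C$3$3$3$1 = 0 \<and> C$3$3$2$3 = 0 \<and>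
    C$1$1$2$2 + 2 * C$1$2$1$2 = a \<and> C$1$1$3$3 + 2 * C$3$1$3$1 = a \<and> C$2$2$3$3 + 2 * C$2$3$2$3 = a \<and>
    C$1$1$2$3 + 2 * C$3$1$1$2 = 0 \<and> C$2$2$3$1 + 2 * C$2$3$1$2 = 0 \<and> C$3$3$1$2 + 2 * C$2$3$3$1 = 0"
    (is "?L \<longleftrightarrow> ?R")
proof
  assume L: ?L
  have T: "(C $ i $ j $ k $ l + C $ i $ k $ j $ l + C $ i $ l $ j $ k) = a * isotropic_sym i j k l" for i j k l
    using L[rule_format, of i j k l] unfolding total_sym_elasticity[OF assms] by simp
  note T = T[unfolded isotropic_sym_def Let_def]
  show ?R
    using T[of 1 1 1 1] T[of 2 2 2 2] T[of 3 3 3 3]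
      T[of 1 1 1 2] T[of 1 1 3 1] T[of 2 2 1 2]
      T[of 2 2 2 3] T[of 3 3 3 1] T[of 3 3 2 3]
      T[of 1 1 2 2] T[of 1 1 3 3] T[of 2 2 3 3]
      T[of 1 1 2 3] T[of 2 2 3 1] T[of 3 3 1 2]
    by (simp add: mat_def elasticity_tensor_canonical[OF assms])
next
  assume ?R
  \<comment> \<open>Each equation is solved for one component so that it can serve as a rewrite rule
    in the 81 index cases.\<close>
  then have R: 
    "C$1$1$1$1 = a" "C$2$2$2$2 = a" "C$3$3$3$3 = a" "C$1$1$1$2 = 0" "C$1$1$3$1 = 0"
    "C$2$2$1$2 = 0" "C$2$2$2$3 = 0" "C$3$3$3$1 = 0" "C$3$3$2$3 = 0"
    "C$1$1$2$2 = a - 2 * C$1$2$1$2" "C$1$1$3$3 = a - 2 * C$3$1$3$1" "C$2$2$3$3 = a - 2 * C$2$3$2$3"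
    "C$1$1$2$3 = - 2 * C$3$1$1$2" "C$2$2$3$1 = - 2 * C$2$3$1$2" "C$3$3$1$2 = - 2 * C$2$3$3$1"
    by linarith+
  have "C $ i $ j $ k $ l + C $ i $ k $ j $ l + C $ i $ l $ j $ k = a * isotropic_sym i j k l" for i j k l
    using exhaust_3[of i] exhaust_3[of j] exhaust_3[of k] exhaust_3[of l]
    by (elim disjE; simp only: elasticity_tensor_canonical[OF assms] R isotropic_sym_def Let_def; simp add: mat_def)
  then show ?L
    unfolding total_sym_elasticity[OF assms] by simp
qed

text \<open>Each of the six parameters describes the solution line of one two-component equation:
  \<open>X + 2 * Y = a\<close> through \<open>X = a / 3 + 2 * \<rho>\<close>,
  \<open>Y = a / 3 - \<rho>\<close>, and \<open>X + 2 * Y = 0\<close> through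
  \<open>X = 2 * \<rho>\<close>, \<open>Y = - \<rho>\<close>.\<close>

lemma voigt_eq_iff:
  assumes el: "elasticity_tensor C"
  shows "(\<exists>\<rho>\<^sub>1 \<rho>\<^sub>2 \<rho>\<^sub>3 \<rho>\<^sub>4 \<rho>\<^sub>5 \<rho>\<^sub>6. voigt C = polarization_matrix a \<rho>\<^sub>1 \<rho>\<^sub>2 \<rho>\<^sub>3 \<rho>\<^sub>4 \<rho>\<^sub>5 \<rho>\<^sub>6)
    \<longleftrightarrow> (\<forall>i j k l. total_sym C $ i $ j $ k $ l = a / 3 * isotropic_sym i j k l)"
    (is "?L \<longleftrightarrow> ?R")
proof -
  have voigt: "voigt C = polarization_matrix a \<rho>\<^sub>1 \<rho>\<^sub>2 \<rho>\<^sub>3 \<rho>\<^sub>4 \<rho>\<^sub>5 \<rho>\<^sub>6 \<longleftrightarrow>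
    C$1$1$1$1 = a \<and> C$2$2$2$2 = a \<and> C$3$3$3$3 = a \<and>
    C$1$1$1$2 = 0 \<and> C$1$1$3$1 = 0 \<and> C$2$2$1$2 = 0 \<and> C$2$2$2$3 = 0 \<and> C$3$3$3$1 = 0 \<and> C$3$3$2$3 = 0 \<and>
    C$1$1$2$2 = a / 3 + 2 * \<rho>\<^sub>1 \<and> C$1$2$1$2 = a / 3 - \<rho>\<^sub>1 \<and>
    C$1$1$3$3 = a / 3 + 2 * \<rho>\<^sub>2 \<and> C$3$1$3$1 = a / 3 - \<rho>\<^sub>2 \<and>
    C$2$2$3$3 = a / 3 + 2 * \<rho>\<^sub>4 \<and> C$2$3$2$3 = a / 3 - \<rho>\<^sub>4 \<and>
    C$1$1$2$3 = 2 * \<rho>\<^sub>3 \<and> C$3$1$1$2 = - \<rho>\<^sub>3 \<and>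
    C$2$2$3$1 = 2 * \<rho>\<^sub>5 \<and> C$2$3$1$2 = - \<rho>\<^sub>5 \<and>
    C$3$3$1$2 = 2 * \<rho>\<^sub>6 \<and> C$2$3$3$1 = - \<rho>\<^sub>6"
    for \<rho>\<^sub>1 \<rho>\<^sub>2 \<rho>\<^sub>3 \<rho>\<^sub>4 \<rho>\<^sub>5 \<rho>\<^sub>6
    unfolding vec_eq_iff forall_6 voigt_def polarization_matrix_def vector_6 vec_lambda_beta
      voigt_pair_simps fst_conv snd_conv elasticity_tensor_canonical[OF el] by blast
  show ?thesis
  proof
    assume ?L
    then show ?R
      unfolding total_sym_eq_iff[OF el] voigt by (elim exE conjE) (intro conjI; linarith)
  next
    assume ?R
    \<comment> \<open>The parameters are read off from the lower right block of the Voigt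
      matrix.\<close>
    then have "voigt C = polarization_matrix a (a / 3 - C$1$2$1$2) (a / 3 - C$3$1$3$1)
      (- C$3$1$1$2) (a / 3 - C$2$3$2$3) (- C$2$3$1$2) (- C$2$3$3$1)"
      unfolding total_sym_eq_iff[OF el] voigt by (elim conjE) (intro conjI; (linarith | simp))
    then show ?L by blast
  qed
qed

section \<open>The cubic map sending \<open>x\<close> to \<open>christoffel C x *v x\<close>\<close>

text \<open>This vector is a quarter of the gradient of the quartic form of \<open>C\<close>, so up
  to integer factors its coefficients are the 15 combinations in
  \<open>total_sym_eq_iff\<close>.\<close>

lemma christoffel_mult_self:
  fixes x :: "real^3"
  assumes "elasticity_tensor C"
  defines "F \<equiv> christoffel C x *v x"
  shows "F$1 = C$1$1$1$1 * x$1^3 + 3 * C$1$1$1$2 * x$1^2 * x$2 + 3 * C$1$1$3$1 * x$1^2 * x$3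
      + (C$1$1$2$2 + 2 * C$1$2$1$2) * x$1 * x$2^2 + (C$1$1$3$3 + 2 * C$3$1$3$1) * x$1 * x$3^2
      + 2 * (C$1$1$2$3 + 2 * C$3$1$1$2) * x$1 * x$2 * x$3 + C$2$2$1$2 * x$2^3
      + (C$2$2$3$1 + 2 * C$2$3$1$2) * x$2^2 * x$3 + (C$3$3$1$2 + 2 * C$2$3$3$1) * x$2 * x$3^2
      + C$3$3$3$1 * x$3^3" (is ?F1)
    and "F$2 = C$1$1$1$2 * x$1^3 + (C$1$1$2$2 + 2 * C$1$2$1$2) * x$1^2 * x$2
      + (C$1$1$2$3 + 2 * C$3$1$1$2) * x$1^2 * x$3 + 3 * C$2$2$1$2 * x$1 * x$2^2
      + 2 * (C$2$2$3$1 + 2 * C$2$3$1$2) * x$1 * x$2 * x$3 + (C$3$3$1$2 + 2 * C$2$3$3$1) * x$1 * x$3^2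
      + C$2$2$2$2 * x$2^3 + 3 * C$2$2$2$3 * x$2^2 * x$3 + (C$2$2$3$3 + 2 * C$2$3$2$3) * x$2 * x$3^2
      + C$3$3$2$3 * x$3^3" (is ?F2)
    and "F$3 = C$1$1$3$1 * x$1^3 + (C$1$1$2$3 + 2 * C$3$1$1$2) * x$1^2 * x$2
      + (C$1$1$3$3 + 2 * C$3$1$3$1) * x$1^2 * x$3 + (C$2$2$3$1 + 2 * C$2$3$1$2) * x$1 * x$2^2
      + 2 * (C$3$3$1$2 + 2 * C$2$3$3$1) * x$1 * x$2 * x$3 + 3 * C$3$3$3$1 * x$1 * x$3^2
      + C$2$2$2$3 * x$2^3 + (C$2$2$3$3 + 2 * C$2$3$2$3) * x$2^2 * x$3 + 3 * C$3$3$2$3 * x$2 * x$3^2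
      + C$3$3$3$3 * x$3^3" (is ?F3)
proof -
  have F: "F $ i = (\<Sum>l\<in>UNIV. (\<Sum>j\<in>UNIV. \<Sum>k\<in>UNIV. C $ i $ j $ k $ l * x $ j * x $ k) * x $ l)" for i
    by (simp add: F_def christoffel_def matrix_vector_mult_def)
  show ?F1 ?F2 ?F3
    unfolding F sum_3 elasticity_tensor_canonical[OF assms(1)]
    by (simp_all add: power2_eq_square power3_eq_cube algebra_simps)
qed

text \<open>Here the quartic form is \<open>a * (x \<bullet> x)^2\<close>, and a quarter of its
  gradient is radial.\<close>

lemma christoffel_mult_self_radial:
  fixes x :: "real^3"
  assumes "elasticity_tensor C"
    and "\<forall>i j k l. total_sym C $ i $ j $ k $ l = a / 3 * isotropic_sym i j k l"
  shows "christoffel C x *v x = (a * (x \<bullet> x)) *\<^sub>R x"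
proof -
  note eqs = assms(2)[unfolded total_sym_eq_iff[OF assms(1)]]
  show ?thesis
    unfolding vec_eq_iff forall_3 christoffel_mult_self[OF assms(1)]
    by (simp add: eqs inner_vec_def sum_3 power2_eq_square power3_eq_cube algebra_simps)
qed

lemma total_sym_isotropic_of_radial:
  assumes el: "elasticity_tensor C"
    and rad: "\<And>x. \<exists>k. christoffel C x *v x = k *\<^sub>R x"
  shows "\<exists>a. \<forall>i j k l. total_sym C $ i $ j $ k $ l = a / 3 * isotropic_sym i j k l"
proof -
  \<comment> \<open>Cross-multiplication eliminates the unknown factor \<open>k\<close>.\<close>
  have par: "x$i * (christoffel C x *v x)$j = x$j * (christoffel C x *v x)$i" for x :: "real^3" and i j
    using rad[of x] by auto
  note P12 = par[of _ 1 2, unfolded christoffel_mult_self[OF el]]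
    and P13 = par[of _ 1 3, unfolded christoffel_mult_self[OF el]]
    and P23 = par[of _ 2 3, unfolded christoffel_mult_self[OF el]]
  \<comment> \<open>On a coordinate axis only one coefficient of a transverse component
    survives.\<close>
  have zero: "C$1$1$1$2 = 0" "C$2$2$1$2 = 0" "C$1$1$3$1 = 0" "C$3$3$3$1 = 0" "C$2$2$2$3 = 0" "C$3$3$2$3 = 0"
    using P12[of "vector [1, 0, 0]"] P12[of "vector [0, 1, 0]"] P13[of "vector [1, 0, 0]"]
      P13[of "vector [0, 0, 1]"] P23[of "vector [0, 1, 0]"] P23[of "vector [0, 0, 1]"]
    by simp_all
  \<comment> \<open>Opposite signs of one coordinate separate the terms odd in it from the even
    ones.\<close>
  have mixed: "C$1$1$2$3 + 2 * C$3$1$1$2 = 0" "C$2$2$3$1 + 2 * C$2$3$1$2 = 0"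
      "C$3$3$1$2 + 2 * C$2$3$3$1 = 0"
    using P13[of "vector [1, 1, 0]"] P13[of "vector [1, -1, 0]"]
      P12[of "vector [1, 0, 1]"] P12[of "vector [1, 0, -1]"] zero
    by simp_all
  \<comment> \<open>With two equal coordinates the two-component combinations cancel, leaving the
    pure ones.\<close>
  have diag: "C$2$2$2$2 = C$1$1$1$1" "C$3$3$3$3 = C$1$1$1$1"
    using P12[of "vector [1, 1, 0]"] P13[of "vector [1, 0, 1]"] zero by simp_all
  \<comment> \<open>Unequal coordinates keep these combinations from cancelling.\<close>
  have "C$1$1$2$2 + 2 * C$1$2$1$2 = C$1$1$1$1" "C$1$1$3$3 + 2 * C$3$1$3$1 = C$1$1$1$1"
      "C$2$2$3$3 + 2 * C$2$3$2$3 = C$1$1$1$1"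
    using P12[of "vector [1, 2, 0]"] P13[of "vector [1, 0, 2]"] P23[of "vector [0, 1, 2]"]
      zero diag by simp_all
  with zero mixed diag show ?thesis
    unfolding total_sym_eq_iff[OF el] by blast
qed

section \<open>Eigenvectors in the plane orthogonal to \<open>n\<close>\<close>

lemma orthogonal_plane_expand:
  fixes n e w :: "real^3"
  assumes "norm n = 1" "norm e = 1" "n \<bullet> e = 0" "w \<bullet> n = 0"
  shows "w = (w \<bullet> e) *\<^sub>R e + (w \<bullet> cross3 n e) *\<^sub>R cross3 n e"
proof -
  let ?f = "cross3 n e"
  have nn: "n \<bullet> n = 1" "e \<bullet> e = 1" using assms by (simp_all add: dot_square_norm)
  have ff: "?f \<bullet> ?f = 1" using assms nn by (simp add: dot_cross inner_commute)
  have "w - (w \<bullet> ?f) *\<^sub>R ?f = cross3 ?f (cross3 w ?f)"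
    unfolding Lagrange[of ?f] ff by (simp add: inner_commute)
  \<comment> \<open>The triple product expansion of \<open>cross3 w (cross3 n e)\<close> reduces to
    a multiple of \<open>n\<close> because \<open>w \<bullet> n = 0\<close>.\<close>
  also have "\<dots> = (w \<bullet> e) *\<^sub>R cross3 ?f n"
    using assms by (simp add: Lagrange cross_mult_right)
  also have "cross3 ?f n = e"
    using assms nn by (subst cross_skew) (simp add: Lagrange)
  finally show ?thesis by (simp add: algebra_simps)
qed

text \<open>The discriminant is a sum of squares, so both eigenvalues are real. The eigenvectors
  \<open>(q, l - p)\<close> and \<open>(q, m - p)\<close> are orthogonal because
  \<open>(l - p) * (m - p) = - (q * q)\<close>. For \<open>q = 0\<close> one of them would vanish,
  and the coordinate vectors are taken instead.\<close>

lemma symmetric_2_eigenvectors: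
  fixes p q r :: real
  obtains l\<^sub>1 a\<^sub>1 b\<^sub>1 l\<^sub>2 a\<^sub>2 b\<^sub>2 where
    "a\<^sub>1 \<noteq> 0 \<or> b\<^sub>1 \<noteq> 0" "a\<^sub>2 \<noteq> 0 \<or> b\<^sub>2 \<noteq> 0" "a\<^sub>1 * a\<^sub>2 + b\<^sub>1 * b\<^sub>2 = 0"
    "p * a\<^sub>1 + q * b\<^sub>1 = l\<^sub>1 * a\<^sub>1" "q * a\<^sub>1 + r * b\<^sub>1 = l\<^sub>1 * b\<^sub>1"
    "p * a\<^sub>2 + q * b\<^sub>2 = l\<^sub>2 * a\<^sub>2" "q * a\<^sub>2 + r * b\<^sub>2 = l\<^sub>2 * b\<^sub>2"
proof (cases "q = 0")
  case True
  then show ?thesis using that[of 1 0 0 1 p r] by simp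
next
  case False
  define D where "D = sqrt ((p - r)\<^sup>2 + 4 * q\<^sup>2)"
  define l m where "l = (p + r + D) / 2" and "m = (p + r - D) / 2"
  have D: "D * D = (p - r) * (p - r) + 4 * (q * q)"
    by (simp add: D_def flip: power2_eq_square)
  have vieta: "l + m = p + r" "l * m = p * r - q * q"
    using D by (simp_all add: l_def m_def field_simps)
  have "(l - p) * (l - r) = q * q" "(m - p) * (m - r) = q * q" "(l - p) * (m - p) = - (q * q)"
    using vieta by algebra+
  then show ?thesis
    using False by (intro that[of q "l - p" q "m - p" l m]) (simp_all add: algebra_simps)
qed

text \<open>In the orthonormal basis \<open>e\<close>, \<open>f\<close> of the invariant plane,
  \<open>G\<close> acts by the symmetric matrix with entries \<open>p\<close>, \<open>q\<close>,
  \<open>q\<close>, \<open>r\<close>.\<close>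

lemma eigenvectors_orthogonal_plane:
  fixes G :: "real^3^3"
  assumes sym: "transpose G = G" and n: "norm n = 1" and ev: "G *v n = c *\<^sub>R n"
  obtains l\<^sub>1 U\<^sub>1 l\<^sub>2 U\<^sub>2 where
    "U\<^sub>1 \<noteq> 0" "U\<^sub>2 \<noteq> 0" "U\<^sub>1 \<bullet> n = 0" "U\<^sub>2 \<bullet> n = 0" "U\<^sub>1 \<bullet> U\<^sub>2 = 0"
    "G *v U\<^sub>1 = l\<^sub>1 *\<^sub>R U\<^sub>1" "G *v U\<^sub>2 = l\<^sub>2 *\<^sub>R U\<^sub>2"
proof -
  have selfadj: "(G *v x) \<bullet> y = x \<bullet> (G *v y)" for x y
    using dot_lmul_matrix[of x G y] vector_transpose_matrix[of x G] sym by simp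
  obtain e0 where e0: "e0 \<noteq> 0" "orthogonal n e0"
    using orthogonal_to_vector_exists[of n] by auto
  define e where "e = e0 /\<^sub>R norm e0"
  have e: "norm e = 1" "n \<bullet> e = 0" using e0 by (simp_all add: e_def orthogonal_def)
  define f where "f = cross3 n e"
  have nn: "n \<bullet> n = 1" "e \<bullet> e = 1" using n e by (simp_all add: dot_square_norm)
  have f: "f \<bullet> f = 1" "e \<bullet> f = 0" "n \<bullet> f = 0"
    using e nn by (simp_all add: f_def dot_cross dot_cross_self inner_commute)
  have plane: "(G *v w) \<bullet> n = 0" if "w \<bullet> n = 0" for w
    using that by (simp add: selfadj ev)
  define p q r where "p = (G *v e) \<bullet> e" and "q = (G *v e) \<bullet> f" and "r = (G *v f) \<bullet> f"
  have "(G *v f) \<bullet> e = q" using selfadj[of f e] by (simp add: q_def inner_commute)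
  moreover have "w \<bullet> n = 0 \<Longrightarrow> G *v w = ((G *v w) \<bullet> e) *\<^sub>R e + ((G *v w) \<bullet> f) *\<^sub>R f" for w
    unfolding f_def by (rule orthogonal_plane_expand[OF n e plane])
  ultimately have G: "G *v e = p *\<^sub>R e + q *\<^sub>R f" "G *v f = q *\<^sub>R e + r *\<^sub>R f"
    using e f by (metis inner_commute p_def q_def r_def)+
  obtain l\<^sub>1 a\<^sub>1 b\<^sub>1 l\<^sub>2 a\<^sub>2 b\<^sub>2 where s:
    "a\<^sub>1 \<noteq> 0 \<or> b\<^sub>1 \<noteq> 0" "a\<^sub>2 \<noteq> 0 \<or> b\<^sub>2 \<noteq> 0" "a\<^sub>1 * a\<^sub>2 + b\<^sub>1 * b\<^sub>2 = 0"
    "p * a\<^sub>1 + q * b\<^sub>1 = l\<^sub>1 * a\<^sub>1" "q * a\<^sub>1 + r * b\<^sub>1 = l\<^sub>1 * b\<^sub>1"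
    "p * a\<^sub>2 + q * b\<^sub>2 = l\<^sub>2 * a\<^sub>2" "q * a\<^sub>2 + r * b\<^sub>2 = l\<^sub>2 * b\<^sub>2"
    by (rule symmetric_2_eigenvectors[of p q r])
  have nz: "a *\<^sub>R e + b *\<^sub>R f \<noteq> 0" if "a \<noteq> 0 \<or> b \<noteq> 0" for a b
  proof -
    have "(a *\<^sub>R e + b *\<^sub>R f) \<bullet> e = a" "(a *\<^sub>R e + b *\<^sub>R f) \<bullet> f = b"
      by (simp_all add: inner_add_left nn f inner_commute[of f e])
    then show ?thesis using that by (metis inner_zero_left)
  qed
  have eig: "G *v (a *\<^sub>R e + b *\<^sub>R f) = l *\<^sub>R (a *\<^sub>R e + b *\<^sub>R f)"
    if "p * a + q * b = l * a" "q * a + r * b = l * b" for a b l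
  proof -
    have "G *v (a *\<^sub>R e + b *\<^sub>R f) = (p * a + q * b) *\<^sub>R e + (q * a + r * b) *\<^sub>R f"
      by (simp add: matrix_vector_right_distrib matrix_vector_mult_scaleR G algebra_simps)
    then show ?thesis by (simp only: that scaleR_add_right scaleR_scaleR)
  qed
  have en: "e \<bullet> n = 0" "f \<bullet> n = 0" "f \<bullet> e = 0" using e f by (metis inner_commute)+
  have perp: "(a *\<^sub>R e + b *\<^sub>R f) \<bullet> n = 0" for a b
    by (simp add: inner_add_left en)
  have orth: "(a\<^sub>1 *\<^sub>R e + b\<^sub>1 *\<^sub>R f) \<bullet> (a\<^sub>2 *\<^sub>R e + b\<^sub>2 *\<^sub>R f) = 0"
    using s(3) by (simp add: inner_add_left inner_add_right nn f(1,2) en(3) mult.commute)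
  show ?thesis
    by (rule that[OF nz[OF s(1)] nz[OF s(2)] perp perp orth eig[OF s(4,5)] eig[OF s(6,7)]])
qed

section \<open>Waves as eigenvectors of the Christoffel matrix\<close>

lemma wave_iff:
  "wave C n v U \<longleftrightarrow> v > 0 \<and> U \<noteq> 0 \<and> christoffel C n *v U = v\<^sup>2 *\<^sub>R U"
  by (auto simp: wave_def matrix_vector_mult_diff_rdistrib scaleR_matrix_vector_assoc[symmetric])

text \<open>The symmetries of \<open>C\<close> exchange the outer indices at the cost of exchanging
  the inner ones, which are summed against a symmetric product.\<close>

lemma transpose_christoffel:
  assumes "elasticity_tensor C"
  shows "transpose (christoffel C n) = christoffel C n"
proof -
  have C: "C $ l $ j $ k $ i = C $ i $ k $ j $ l" for i j k l
    using assms unfolding elasticity_tensor_def by metis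
  have "(\<Sum>j\<in>UNIV. \<Sum>k\<in>UNIV. C $ l $ j $ k $ i * n $ j * n $ k)
    = (\<Sum>j\<in>UNIV. \<Sum>k\<in>UNIV. C $ i $ j $ k $ l * n $ j * n $ k)" for i l
    by (subst sum.swap) (simp add: C mult.commute mult.left_commute)
  then show ?thesis
    by (simp add: transpose_def christoffel_def vec_eq_iff)
qed

lemma christoffel_scaleR: "christoffel C (c *\<^sub>R n) = c\<^sup>2 *\<^sub>R christoffel C n"
  by (simp add: christoffel_def vec_eq_iff sum_distrib_left power2_eq_square mult_ac)

lemma longitudinal_wave_iff:
  assumes "norm n = 1" "christoffel C n *v n = a *\<^sub>R n" "a > 0"
  shows "(\<exists>U. longitudinal_wave C n v U) \<longleftrightarrow> v = sqrt a"
proof -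
  have n: "n \<noteq> 0" using assms(1) by auto
  show ?thesis
  proof
    assume "\<exists>U. longitudinal_wave C n v U"
    then obtain c where v: "v > 0" "c \<noteq> 0"
      and ev: "christoffel C n *v (c *\<^sub>R n) = v\<^sup>2 *\<^sub>R c *\<^sub>R n"
      by (auto simp: longitudinal_wave_def wave_iff)
    have "v\<^sup>2 = a"
      using ev v n by (simp add: matrix_vector_mult_scaleR assms(2))
    then show "v = sqrt a" using v by (simp add: real_sqrt_unique)
  next
    assume "v = sqrt a"
    then have "longitudinal_wave C n v n"
      using assms n by (auto simp: longitudinal_wave_def wave_iff intro: exI[of _ 1])
    then show "\<exists>U. longitudinal_wave C n v U" ..
  qed
qed

text \<open>Makes every eigenvalue the square of a positive velocity.\<close>

lemma pos_definite_eigenvalue_pos: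
  assumes "pos_definite G" "U \<noteq> 0" "G *v U = l *\<^sub>R U"
  shows "l > 0"
proof -
  have "0 < U \<bullet> (G *v U)" using assms(1,2) by (simp add: pos_definite_def)
  then have "0 < l * (U \<bullet> U)" unfolding assms(3) by simp
  then show ?thesis using inner_ge_zero[of U] by (simp add: zero_less_mult_iff)
qed

lemma purely_polarized_waves_iff:
  assumes el: "elasticity_tensor C" and pd: "pos_definite (christoffel C n)" and n: "norm n = 1"
  shows "purely_polarized_waves C n \<longleftrightarrow> (\<exists>c. christoffel C n *v n = c *\<^sub>R n)"
proof
  assume "purely_polarized_waves C n"
  then obtain v c where "c \<noteq> 0" and ev: "christoffel C n *v (c *\<^sub>R n) = v\<^sup>2 *\<^sub>R c *\<^sub>R n"
    by (auto simp: purely_polarized_waves_def longitudinal_wave_def wave_iff)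
  then have "c *\<^sub>R (christoffel C n *v n) = c *\<^sub>R v\<^sup>2 *\<^sub>R n"
    by (simp add: matrix_vector_mult_scaleR mult.commute)
  with \<open>c \<noteq> 0\<close> have "christoffel C n *v n = v\<^sup>2 *\<^sub>R n" by (simp only: scaleR_cancel_left) simp
  then show "\<exists>c. christoffel C n *v n = c *\<^sub>R n" ..
next
  assume "\<exists>c. christoffel C n *v n = c *\<^sub>R n"
  then obtain c where c: "christoffel C n *v n = c *\<^sub>R n" ..
  have "n \<noteq> 0" using n by auto
  then have long: "\<exists>v U. longitudinal_wave C n v U"
    using longitudinal_wave_iff[OF n c] pos_definite_eigenvalue_pos[OF pd _ c] by blast
  obtain l\<^sub>1 U\<^sub>1 l\<^sub>2 U\<^sub>2 where U: "U\<^sub>1 \<noteq> 0" "U\<^sub>2 \<noteq> 0" "U\<^sub>1 \<bullet> n = 0" "U\<^sub>2 \<bullet> n = 0" "U\<^sub>1 \<bullet> U\<^sub>2 = 0"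
    "christoffel C n *v U\<^sub>1 = l\<^sub>1 *\<^sub>R U\<^sub>1" "christoffel C n *v U\<^sub>2 = l\<^sub>2 *\<^sub>R U\<^sub>2"
    by (rule eigenvectors_orthogonal_plane[OF transpose_christoffel[OF el] n c])
  have l: "l\<^sub>1 > 0" "l\<^sub>2 > 0"
    using pos_definite_eigenvalue_pos[OF pd] U by blast+
  have "transverse_wave C n (sqrt l\<^sub>1) U\<^sub>1" "transverse_wave C n (sqrt l\<^sub>2) U\<^sub>2"
    using U l by (simp_all add: transverse_wave_def wave_iff)
  moreover have "U\<^sub>1 \<noteq> U\<^sub>2" using U by auto
  \<comment> \<open>Nonzero orthogonal polarizations are independent, even when the two velocities
    coincide.\<close>
  moreover have "independent {U\<^sub>1, U\<^sub>2}"
    using U by (intro pairwise_orthogonal_independent)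
      (auto simp: pairwise_def orthogonal_def inner_commute)
  ultimately show "purely_polarized_waves C n"
    using long unfolding purely_polarized_waves_def by blast
qed

text \<open>Cubic homogeneity carries the condition from unit vectors to all vectors, so that test
  vectors with integer coordinates become available.\<close>

lemma christoffel_radial_all:
  assumes "\<And>n. norm n = 1 \<Longrightarrow> \<exists>c. christoffel C n *v n = c *\<^sub>R n"
  shows "\<exists>c. christoffel C x *v x = c *\<^sub>R x"
proof (cases "x = 0")
  case False
  define n where "n = x /\<^sub>R norm x"
  have x: "x = norm x *\<^sub>R n" and "norm n = 1" using False by (simp_all add: n_def)
  then obtain c where "christoffel C n *v n = c *\<^sub>R n" using assms by blast
  then have "christoffel C (norm x *\<^sub>R n) *v (norm x *\<^sub>R n) = ((norm x)\<^sup>2 * c) *\<^sub>R norm x *\<^sub>R n"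
    by (simp add: christoffel_scaleR matrix_vector_mult_scaleR scaleR_matrix_vector_assoc[symmetric] mult_ac)
  then show ?thesis using x by metis
qed simp

text \<open>Symmetrization respects differences and fixes the symmetrized isotropic tensor, so
  \<open>A\<close> must be the difference, and its symmetrization vanishes exactly when the two
  symmetrizations agree.\<close>

lemma total_sym_decomposition_iff:
  assumes el: "elasticity_tensor C"
  shows "(\<exists>A. elasticity_tensor A \<and> total_sym A = 0 \<and> C = total_sym (isotropic_tensor lam \<mu>) + A)
    \<longleftrightarrow> total_sym C = total_sym (isotropic_tensor lam \<mu>)"
proof -
  let ?S = "total_sym (isotropic_tensor lam \<mu>)"
  have sym: "isotropic_sym j i k l = isotropic_sym i j k l" "isotropic_sym i j l k = isotropic_sym i j k l" "isotropic_sym k l i j = isotropic_sym i j k l"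
      "isotropic_sym i k j l = isotropic_sym i j k l" "isotropic_sym i l j k = isotropic_sym i j k l" for i j k l
    by (simp_all only: isotropic_sym_def Let_def mat_1_commute mult.commute add.commute add.left_commute)
  have S: "elasticity_tensor ?S"
    by (simp add: elasticity_tensor_def total_sym_isotropic sym(1,2)) (simp add: sym(3))
  have "total_sym ?S $ i $ j $ k $ l = ?S $ i $ j $ k $ l" for i j k l
    unfolding total_sym_elasticity[OF S] total_sym_isotropic sym(4)[of i k j l] sym(5)[of i l j k]
    by simp
  then have "total_sym ?S = ?S" by (simp add: vec_eq_iff)
  then have diff: "total_sym (C - ?S) = total_sym C - ?S"
    by (simp add: total_sym_diff)
  have "elasticity_tensor (C - ?S)"
    using el S by (simp add: elasticity_tensor_def)
  moreover have "C = ?S + A \<longleftrightarrow> A = C - ?S" for A by auto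
  ultimately show ?thesis
    by (auto simp: diff)
qed

theorem proposition17:
  fixes C :: tensor4
  assumes "elasticity_tensor C"
    and "\<And>n. norm n = 1 \<Longrightarrow> pos_definite (christoffel C n)"
  shows "((\<forall>n. norm n = 1 \<longrightarrow> purely_polarized_waves C n) \<longleftrightarrow>
            (\<exists>a \<rho>\<^sub>1 \<rho>\<^sub>2 \<rho>\<^sub>3 \<rho>\<^sub>4 \<rho>\<^sub>5 \<rho>\<^sub>6. voigt C = polarization_matrix a \<rho>\<^sub>1 \<rho>\<^sub>2 \<rho>\<^sub>3 \<rho>\<^sub>4 \<rho>\<^sub>5 \<rho>\<^sub>6))
       \<and> (\<forall>\<alpha> lam \<mu>. \<alpha> = (lam + 2 * \<mu>) / 3 \<longrightarrow>
            ((\<exists>\<rho>\<^sub>1 \<rho>\<^sub>2 \<rho>\<^sub>3 \<rho>\<^sub>4 \<rho>\<^sub>5 \<rho>\<^sub>6. voigt C = polarization_matrix (3 * \<alpha>) \<rho>\<^sub>1 \<rho>\<^sub>2 \<rho>\<^sub>3 \<rho>\<^sub>4 \<rho>\<^sub>5 \<rho>\<^sub>6) \<longleftrightarrow>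
             (\<exists>A. elasticity_tensor A \<and> total_sym A = 0 \<and>
                  C = total_sym (isotropic_tensor lam \<mu>) + A))
          \<and> ((\<exists>\<rho>\<^sub>1 \<rho>\<^sub>2 \<rho>\<^sub>3 \<rho>\<^sub>4 \<rho>\<^sub>5 \<rho>\<^sub>6. voigt C = polarization_matrix (3 * \<alpha>) \<rho>\<^sub>1 \<rho>\<^sub>2 \<rho>\<^sub>3 \<rho>\<^sub>4 \<rho>\<^sub>5 \<rho>\<^sub>6) \<longrightarrow>
             (\<forall>n v. norm n = 1 \<longrightarrow>
                ((\<exists>U. longitudinal_wave C n v U) \<longleftrightarrow> v = sqrt (3 * \<alpha>))) \<and>
             sqrt (3 * \<alpha>) = sqrt (lam + 2 * \<mu>)))"
proof (intro conjI allI impI)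
  note el = assms(1)
  note voigt = voigt_eq_iff[OF el]
  have radial: "christoffel C n *v n = a *\<^sub>R n"
    if "\<forall>i j k l. total_sym C $ i $ j $ k $ l = a / 3 * isotropic_sym i j k l" "norm n = 1" for a n
    using christoffel_mult_self_radial[OF el that(1), of n] that(2) by (simp add: dot_square_norm)
  have pure: "purely_polarized_waves C n \<longleftrightarrow> (\<exists>c. christoffel C n *v n = c *\<^sub>R n)" if "norm n = 1" for n
    by (rule purely_polarized_waves_iff[OF el assms(2)[OF that] that])
  show "(\<forall>n. norm n = 1 \<longrightarrow> purely_polarized_waves C n) \<longleftrightarrow>
      (\<exists>a \<rho>\<^sub>1 \<rho>\<^sub>2 \<rho>\<^sub>3 \<rho>\<^sub>4 \<rho>\<^sub>5 \<rho>\<^sub>6. voigt C = polarization_matrix a \<rho>\<^sub>1 \<rho>\<^sub>2 \<rho>\<^sub>3 \<rho>\<^sub>4 \<rho>\<^sub>5 \<rho>\<^sub>6)"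
    \<comment> \<open>This replaces the six parameters by the condition that the symmetrization is
      isotropic.\<close>
    unfolding voigt
  proof
    assume all: "\<forall>n. norm n = 1 \<longrightarrow> purely_polarized_waves C n"
    have "\<exists>c. christoffel C x *v x = c *\<^sub>R x" for x
      by (rule christoffel_radial_all) (use all pure in simp)
    then show "\<exists>a. \<forall>i j k l. total_sym C $ i $ j $ k $ l = a / 3 * isotropic_sym i j k l"
      by (rule total_sym_isotropic_of_radial[OF el])
  next
    assume "\<exists>a. \<forall>i j k l. total_sym C $ i $ j $ k $ l = a / 3 * isotropic_sym i j k l"
    then show "\<forall>n. norm n = 1 \<longrightarrow> purely_polarized_waves C n"
      using radial pure by blast
  qed
  fix \<alpha> lam \<mu> :: real
  assume \<alpha>: "\<alpha> = (lam + 2 * \<mu>) / 3"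
  show "(\<exists>\<rho>\<^sub>1 \<rho>\<^sub>2 \<rho>\<^sub>3 \<rho>\<^sub>4 \<rho>\<^sub>5 \<rho>\<^sub>6. voigt C = polarization_matrix (3 * \<alpha>) \<rho>\<^sub>1 \<rho>\<^sub>2 \<rho>\<^sub>3 \<rho>\<^sub>4 \<rho>\<^sub>5 \<rho>\<^sub>6) \<longleftrightarrow>
      (\<exists>A. elasticity_tensor A \<and> total_sym A = 0 \<and> C = total_sym (isotropic_tensor lam \<mu>) + A)"
  proof -
    have "3 * \<alpha> / 3 = (lam + 2 * \<mu>) / 3" using \<alpha> by simp
    then show ?thesis
      unfolding voigt total_sym_decomposition_iff[OF el]
      by (simp only: vec_eq_iff total_sym_isotropic)
  qed
  show "sqrt (3 * \<alpha>) = sqrt (lam + 2 * \<mu>)" by (simp add: \<alpha>)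
  fix n :: "real^3" and v :: real
  assume mat: "\<exists>\<rho>\<^sub>1 \<rho>\<^sub>2 \<rho>\<^sub>3 \<rho>\<^sub>4 \<rho>\<^sub>5 \<rho>\<^sub>6. voigt C = polarization_matrix (3 * \<alpha>) \<rho>\<^sub>1 \<rho>\<^sub>2 \<rho>\<^sub>3 \<rho>\<^sub>4 \<rho>\<^sub>5 \<rho>\<^sub>6" and n: "norm n = 1"
  have ev: "christoffel C n *v n = (3 * \<alpha>) *\<^sub>R n"
    by (rule radial[OF mat[unfolded voigt] n])
  \<comment> \<open>Positive definiteness in the direction \<open>n\<close> makes the longitudinal
    eigenvalue positive.\<close>
  moreover have "3 * \<alpha> > 0"
    by (rule pos_definite_eigenvalue_pos[OF assms(2)[OF n] _ ev]) (use n in auto)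
  ultimately show "(\<exists>U. longitudinal_wave C n v U) \<longleftrightarrow> v = sqrt (3 * \<alpha>)"
    by (rule longitudinal_wave_iff[OF n])
qed

end
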